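(* Let $n\ge 1$, let $A\subseteq\{1,\dots,n\}$, and put $\mu=\sum_{a\in A}\frac1a$. The proportion $\rho(\mathrm{S}_n)$ of elements of $\mathrm{S}_n$ having no cycle length in $A$ satisfies $\rho(\mathrm{S}_n)<e^{\gamma-\mu}$. The proportion $\rho(\mathrm{A}_n)$ of elements of $\mathrm{A}_n$ having no cycle length in $A$ satisfies $\rho(\mathrm{A}_n)<2e^{\gamma-\mu}$.
   Context: $\mathrm{S}_n$ and $\mathrm{A}_n$ denote the symmetric and alternating groups of degree $n$. The cycle lengths of $g\in\mathrm{S}_n$ are the lengths of all cycles in its disjoint cycle decomposition on $\{1,\dots,n\}$, with fixed points counted as cycles of length $1$. The constant $\gamma=\lim_{n\to\infty}\left(\sum_{k=1}^n\frac1k-\log n\right)=0.5772\cdots$ is the Euler--Mascheroni constant (so $e^\gamma\approx1.781$). *)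

theory Defs
  imports
    "HOL-Algebra.Sym_Groups"
    "HOL-Combinatorics.Orbits"
    "HOL-Analysis.Harmonic_Numbers"
begin

text \<open>
  The cycles of \<open>g\<close> on \<open>{1..n}\<close> are represented by their underlying sets, i.e. the orbits of \<open>g\<close>;
  a fixed point gives a singleton orbit, hence a cycle of length 1.
\<close>

definition cycle_lengths :: "nat \<Rightarrow> (nat \<Rightarrow> nat) \<Rightarrow> nat set" where
  "cycle_lengths n g = (\<lambda>i. card (orbit g i)) ` {1..n}"

definition avoiding_proportion :: "nat \<Rightarrow> (nat \<Rightarrow> nat) monoid \<Rightarrow> nat set \<Rightarrow> real" where
  "avoiding_proportion n G A =
     real (card {g \<in> carrier G. cycle_lengths n g \<inter> A = {}}) / real (order G)"

lemma cycle_of_list_nth: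
  assumes "distinct cs" "k < length cs"
  shows "cycle_of_list cs (cs ! k) = cs ! (Suc k mod length cs)"
proof -
  have "map (cycle_of_list cs) cs = rotate1 cs"
    using cyclic_rotation[OF assms(1), of 1] by simp
  then have "cycle_of_list cs (cs ! k) = rotate1 cs ! k"
    using assms(2) by (metis nth_map)
  then show ?thesis
    using assms by (simp add: nth_rotate1)
qed

lemma orbit_of_cycle:
  assumes "distinct cs" "x \<in> set cs" "\<And>y. y \<in> set cs \<Longrightarrow> g y = cycle_of_list cs y"
  shows "orbit g x = set cs"
proof -
  obtain k where k: "k < length cs" "x = cs ! k"
    using assms(2) by (metis in_set_conv_nth)
  have pos: "0 < length cs" using k(1) by linarith
  have it: "(g ^^ m) x = cs ! ((k + m) mod length cs)" for m
  proof (induction m)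
    case 0
    then show ?case using k by simp
  next
    case (Suc m)
    have "(g ^^ Suc m) x = g (cs ! ((k + m) mod length cs))" using Suc by simp
    also have "\<dots> = cs ! (Suc ((k + m) mod length cs) mod length cs)"
      using assms(1,3) pos by (simp add: cycle_of_list_nth)
    finally show ?case by (simp add: mod_Suc_eq)
  qed
  show ?thesis
  proof (intro Set.set_eqI iffI)
    fix y assume "y \<in> orbit g x"
    then show "y \<in> set cs" using it pos by (auto simp: orbit_altdef)
  next
    fix y assume "y \<in> set cs"
    then obtain j where j: "j < length cs" "y = cs ! j" by (metis in_set_conv_nth)
    have "k + (length cs - k + j) = length cs + j" using k by simp
    then have "(k + (length cs - k + j)) mod length cs = j" using j by simp
    then have "(g ^^ (length cs - k + j)) x = y" using it j by simp
    moreover have "0 < length cs - k + j" using k by simp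
    ultimately show "y \<in> orbit g x" unfolding orbit_altdef by blast
  qed
qed

lemma comp_cycles_apply:
  assumes "distinct (concat css)" "cs \<in> set css" "x \<in> set cs"
  shows "foldr (\<circ>) (map cycle_of_list css) id x = cycle_of_list cs x"
  using assms
proof (induction css)
  case (Cons ds css)
  have outside: "foldr (\<circ>) (map cycle_of_list ess) id y = y"
    if "y \<notin> set (concat ess)" for ess :: "'a list list" and y
    using that by (induction ess) (auto simp: id_outside_supp)
  show ?case
  proof (cases "x \<in> set ds")
    case True
    then have "x \<notin> set (concat css)" using Cons.prems(1) by auto
    then have "foldr (\<circ>) (map cycle_of_list css) id x = x" by (rule outside)
    moreover have "cs = ds" using True Cons.prems by auto
    moreover have "foldr (\<circ>) (map cycle_of_list (ds # css)) id x
        = cycle_of_list ds (foldr (\<circ>) (map cycle_of_list css) id x)"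
      by (simp only: list.map foldr_Cons o_apply)
    ultimately show ?thesis by metis
  next
    case False
    then have cs: "cs \<in> set css" using Cons.prems by auto
    have "cycle_of_list cs x \<in> set cs"
      using Cons.prems(3) cycle_permutes permutes_in_image by metis
    then have "cycle_of_list cs x \<notin> set ds" using cs Cons.prems(1) by auto
    then show ?thesis using cs Cons by (simp add: id_outside_supp)
  qed
qed simp

text \<open>
  Agreement with the disjoint cycle decomposition: \<open>css\<close> lists the disjoint cycles of \<open>g\<close>,
  including the trivial ones, so that they cover \<open>{1..n}\<close>.
\<close>

lemma cycle_lengths_decomposition:
  assumes "distinct (concat css)" "[] \<notin> set css" "set (concat css) = {1..n}"
    and "g = foldr (\<circ>) (map cycle_of_list css) id"
  shows "cycle_lengths n g = length ` set css"
proof -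
  have card: "card (orbit g x) = length cs" if "cs \<in> set css" "x \<in> set cs" for cs x
  proof -
    have "distinct cs" using assms(1) that(1) by (simp add: distinct_concat_iff)
    moreover have "g y = cycle_of_list cs y" if "y \<in> set cs" for y
      using comp_cycles_apply[OF assms(1) \<open>cs \<in> set css\<close> that] assms(4) by simp
    ultimately show ?thesis
      using orbit_of_cycle[of cs x g] that(2) by (simp add: distinct_card)
  qed
  show ?thesis
  proof (intro Set.set_eqI iffI)
    fix l assume "l \<in> cycle_lengths n g"
    then obtain x where x: "x \<in> {1..n}" "l = card (orbit g x)"
      by (auto simp: cycle_lengths_def)
    then have "x \<in> set (concat css)" using assms(3) by blast
    then obtain cs where "cs \<in> set css" "x \<in> set cs" by auto
    then show "l \<in> length ` set css" using card x(2) by auto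
  next
    fix l assume "l \<in> length ` set css"
    then obtain cs where cs: "cs \<in> set css" "l = length cs" by auto
    then have "cs \<noteq> []" using assms(2) by auto
    then have hd: "hd cs \<in> set cs" by simp
    then have "hd cs \<in> {1..n}" using cs(1) assms(3) by auto
    then show "l \<in> cycle_lengths n g"
      unfolding cycle_lengths_def using card[OF cs(1) hd] cs(2) by (metis imageI)
  qed
qed

end

theory Submission
  imports Defs
begin

text \<open>
  Let \<open>p\<^sub>n\<close> be the proportion of permutations of \<open>n\<close> points with no cycle length in \<open>A\<close>. The cycle
  through a fixed point has each length \<open>k \<in> {1..n}\<close> with probability \<open>1/n\<close>, and what remains
  is a uniform permutation of \<open>n - k\<close> points, so
  \<open>n p\<^sub>n = \<Sum>\<^sub>j p\<^sub>j\<close>, summed over the \<open>j < n\<close> with \<open>n - j \<notin> A\<close>. The numbers \<open>avoid_prob A n\<close> are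
  defined by this recursion; since only an upper bound is wanted, it is enough to inject
  permutations into pairs (cycle through the point, rest), which is
  \<open>card_avoiding_perms_le_sum_lists\<close>, and to induct on the number of points
  (\<open>card_avoiding_perms_le\<close>).

  The recursion says that \<open>f(x) = \<Sum>\<^sub>j p\<^sub>j x\<^sup>j\<close> satisfies \<open>f' = f \<Sum>\<^sub>b x\<^bsup>b-1\<^esup>\<close>, with \<open>b\<close> outside \<open>A\<close>.
  After truncation at degree \<open>m\<close> the equation becomes \<open>\<le>\<close> for \<open>x \<ge> 0\<close>, and
  integrating over \<open>[0,1]\<close> gives
  \<open>\<Sum>\<^sub>j\<^sub>\<le>\<^sub>m p\<^sub>j \<le> exp (\<Sum>\<^sub>b 1/b)\<close>, where \<open>b\<close> runs over \<open>{1..m} - A\<close> (\<open>partial_sum_le_exp\<close>).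

  Take \<open>m = n - 1\<close>. The recursion bounds \<open>n p\<^sub>n\<close> by the partial sum, hence by
  \<open>exp (H\<^sub>m - \<nu>)\<close> with \<open>\<nu>\<close> the sum of \<open>1/a\<close> over \<open>a \<in> A\<close> below \<open>n\<close>, and
  \<open>H\<^sub>m < ln n + \<gamma>\<close> finishes the case \<open>n \<notin> A\<close>. Stopping at \<open>m = n - 1\<close> is essential, because
  \<open>H\<^sub>n > ln n + \<gamma>\<close>. If \<open>n \<in> A\<close>, then a further factor \<open>exp (-1/n)\<close> has to be gained. It comes from
  the missing term \<open>p\<^sub>0 = 1\<close> of the recursion when \<open>\<nu> \<ge> \<gamma>\<close>, and for \<open>\<nu> < \<gamma>\<close> from the trivial
  bound \<open>p\<^sub>n \<le> 1 - 1/n\<close> (no \<open>n\<close>-cycles).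

  The alternating group has index at most two, which costs the factor 2.
\<close>

section \<open>Counting permutations that avoid cycle lengths\<close>

text \<open>
  The proportion \<open>p\<^sub>n\<close>, encoded by its recursion so that it depends on the number of points alone.
\<close>

fun avoid_prob :: "nat set \<Rightarrow> nat \<Rightarrow> real" where
  "avoid_prob A n =
     (if n = 0 then 1 else (\<Sum>j | j < n \<and> n - j \<notin> A. avoid_prob A j) / real n)"

declare avoid_prob.simps [simp del]

lemma avoid_prob_0 [simp]: "avoid_prob A 0 = 1"
  by (simp add: avoid_prob.simps)

lemma avoid_prob_rec:
  "n > 0 \<Longrightarrow> real n * avoid_prob A n = (\<Sum>j | j < n \<and> n - j \<notin> A. avoid_prob A j)"
  by (subst avoid_prob.simps) simp

lemma avoid_prob_bounds: "0 \<le> avoid_prob A n \<and> avoid_prob A n \<le> 1"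
proof (induction n rule: less_induct)
  case (less n)
  show ?case
  proof (cases "n = 0")
    case False
    have "(\<Sum>j | j < n \<and> n - j \<notin> A. avoid_prob A j) \<le> (\<Sum>j<n. avoid_prob A j)"
      using less by (intro sum_mono2) auto
    also have "\<dots> \<le> (\<Sum>j<n. 1)"
      using less by (intro sum_mono) auto
    finally have "real n * avoid_prob A n \<le> real n * 1"
      using False by (simp add: avoid_prob_rec)
    moreover have "real n * 0 \<le> real n * avoid_prob A n"
      using False less by (auto simp: avoid_prob_rec intro!: sum_nonneg)
    ultimately show ?thesis
      using False by (simp add: zero_le_mult_iff)
  qed simp
qed

definition avoiding_perms :: "nat set \<Rightarrow> 'a set \<Rightarrow> ('a \<Rightarrow> 'a) set" where
  "avoiding_perms A S = {f. f permutes S \<and> (\<forall>x\<in>S. card (orbit f x) \<notin> A)}"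

lemma finite_avoiding_perms: "finite S \<Longrightarrow> finite (avoiding_perms A S)"
  unfolding avoiding_perms_def by (rule finite_subset[OF _ finite_permutations]) auto

lemma set_support_eq_orbit:
  assumes "permutation f"
  shows "set (support f x) = orbit f x"
  unfolding support_set[OF assms] orbit_altdef_permutation[OF assms] by auto

text \<open>
  Removing one cycle leaves every other cycle untouched, so no forbidden length can appear.
\<close>

lemma avoiding_perms_restrict:
  assumes "finite S" "f \<in> avoiding_perms A S"
  shows "perm_restrict f (S - orbit f x) \<in> avoiding_perms A (S - orbit f x)"
proof -
  have f: "f permutes S" using assms by (simp add: avoiding_perms_def)
  then have perm: "permutation f"
    using assms(1) permutation_permutes by blast
  let ?g = "perm_restrict f (S - orbit f x)"
  have g: "?g permutes (S - orbit f x)"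
    using perm_restrict_diff_cyclic[OF f cyclic_on_orbit[OF f assms(1)]] .
  have "orbit ?g y = orbit f y" if y: "y \<in> S - orbit f x" for y
  proof (rule orbit_cong0)
    show "?g \<in> S - orbit f x \<rightarrow> S - orbit f x"
      by (intro funcsetI) (simp only: permutes_in_image[OF g])
  qed (use y in \<open>auto simp: perm_restrict_simps\<close>)
  then show ?thesis
    using g assms(2) by (auto simp: avoiding_perms_def)
qed

text \<open>
  A permutation is recovered from the cycle through \<open>x\<close>, read off as a list starting at \<open>x\<close>,
  and its restriction to the remaining points. The list \<open>l\<close> records this cycle without \<open>x\<close>,
  so the cycle has length \<open>Suc (length l)\<close>.
\<close>

lemma card_avoiding_perms_le_sum_lists:
  assumes "finite S" "x \<in> S"
  shows "card (avoiding_perms A S) \<le>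
    (\<Sum>l | distinct l \<and> set l \<subseteq> S - {x} \<and> Suc (length l) \<notin> A.
       card (avoiding_perms A (S - insert x (set l))))"
proof -
  let ?L = "{l. distinct l \<and> set l \<subseteq> S - {x} \<and> Suc (length l) \<notin> A}"
  let ?T = "SIGMA l:?L. avoiding_perms A (S - insert x (set l))"
  let ?\<Phi> = "\<lambda>f. (tl (support f x), perm_restrict f (S - orbit f x))"
  have finL: "finite ?L"
    by (rule finite_subset[OF _ finite_subset_distinct[of "S - {x}"]]) (use assms in auto)
  have perm: "permutation f" if "f \<in> avoiding_perms A S" for f
    using that assms(1) permutation_permutes by (auto simp: avoiding_perms_def)
  have supp: "support f x = x # tl (support f x)" if "permutation f" for f
    using least_power_of_permutation(2)[OF that, of x] by (simp add: upt_conv_Cons)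
  have "?\<Phi> ` avoiding_perms A S \<subseteq> ?T"
  proof (rule image_subsetI)
    fix f assume f: "f \<in> avoiding_perms A S"
    define l where "l = tl (support f x)"
    have xl: "support f x = x # l"
      unfolding l_def by (rule supp[OF perm[OF f]])
    have d: "distinct (x # l)"
      using cycle_of_permutation[OF perm[OF f], of x] unfolding xl .
    have o: "orbit f x = insert x (set l)"
      using set_support_eq_orbit[OF perm[OF f], of x] unfolding xl by simp
    have "orbit f x \<subseteq> S"
      using f assms(2) permutes_orbit_subset[of f S x] by (simp add: avoiding_perms_def)
    moreover have "card (orbit f x) \<notin> A"
      using f assms(2) by (auto simp: avoiding_perms_def)
    moreover have "card (orbit f x) = Suc (length l)"
      using d o by (simp add: distinct_card)
    ultimately have "l \<in> ?L"
      using d o by auto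
    then show "?\<Phi> f \<in> ?T"
      using avoiding_perms_restrict[OF assms(1) f, of x] o
      unfolding l_def[symmetric] by simp
  qed
  moreover have "inj_on ?\<Phi> (avoiding_perms A S)"
  proof (rule inj_onI)
    fix f g assume f: "f \<in> avoiding_perms A S" and g: "g \<in> avoiding_perms A S"
      and eq: "?\<Phi> f = ?\<Phi> g"
    have s: "support f x = support g x"
      using supp[OF perm[OF f]] supp[OF perm[OF g]] eq by (metis prod.inject)
    then have o: "orbit f x = orbit g x"
      using set_support_eq_orbit perm f g by metis
    show "f = g"
    proof
      fix y
      consider "y \<in> orbit f x" | "y \<in> S - orbit f x" | "y \<notin> S"
        by blast
      then show "f y = g y"
      proof cases
        case 1
        then have "y \<in> set (support f x)" "y \<in> set (support g x)"
          using set_support_eq_orbit perm f g o by metis+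
        then show ?thesis
          using cycle_restrict[OF perm[OF f], of y x] cycle_restrict[OF perm[OF g], of y x] s
          by metis
      next
        case 2
        have "perm_restrict f (S - orbit f x) y = perm_restrict g (S - orbit g x) y"
          using eq by simp
        then show ?thesis using 2 o by (simp add: perm_restrict_simps)
      next
        case 3
        then show ?thesis
          using f g by (auto simp: avoiding_perms_def permutes_not_in)
      qed
    qed
  qed
  moreover have "finite ?T"
    using finL assms(1) by (intro finite_SigmaI finite_avoiding_perms) auto
  ultimately have "card (avoiding_perms A S) \<le> card ?T"
    by (metis (no_types, lifting) card_image card_mono)
  also have "\<dots> = (\<Sum>l\<in>?L. card (avoiding_perms A (S - insert x (set l))))"
    using finL assms(1) by (intro card_SigmaI) (auto intro: finite_avoiding_perms)
  finally show ?thesis .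
qed

text \<open>
  With \<open>m\<close> points besides \<open>x\<close>, there are \<open>m! / (m - k)!\<close> lists of length \<open>k\<close>. By induction each of
  them leaves at most \<open>(m - k)! p\<^bsub>m-k\<^esub>\<close> permutations of the rest, so the factorials cancel to \<open>m!\<close>
  for every \<open>k\<close> and the recursion for \<open>p\<^bsub>m+1\<^esub>\<close> appears.
\<close>

lemma card_avoiding_perms_le:
  assumes "finite S"
  shows "real (card (avoiding_perms A S)) \<le> fact (card S) * avoid_prob A (card S)"
  using assms
proof (induction S rule: finite_psubset_induct)
  case (psubset S)
  show ?case
  proof (cases "S = {}")
    case True
    then have "avoiding_perms A S \<subseteq> {id}"
      by (auto simp: avoiding_perms_def)
    from card_mono[OF _ this] show ?thesis using True by simp
  next
    case False
    then obtain x where x: "x \<in> S" by blast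
    define m where "m = card (S - {x})"
    have n: "card S = Suc m"
      using card.remove[OF psubset.hyps x] by (simp add: m_def)
    let ?K = "{k. k \<le> m \<and> Suc k \<notin> A}"
    let ?D = "\<lambda>k. {l. length l = k \<and> distinct l \<and> set l \<subseteq> S - {x}}"
    let ?L = "{l. distinct l \<and> set l \<subseteq> S - {x} \<and> Suc (length l) \<notin> A}"
    have len: "length l \<le> m" if "distinct l" "set l \<subseteq> S - {x}" for l
      using that psubset.hyps by (metis card_mono distinct_card finite_Diff m_def)
    have finL: "finite ?L"
      by (rule finite_subset[OF _ finite_subset_distinct[of "S - {x}"]])
        (use psubset.hyps in auto)
    have "real (card (avoiding_perms A S)) \<le>
        (\<Sum>l\<in>?L. real (card (avoiding_perms A (S - insert x (set l)))))"
      using card_avoiding_perms_le_sum_lists[OF psubset.hyps x, of A]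
      unfolding of_nat_sum[symmetric] of_nat_le_iff .
    also have "\<dots> \<le> (\<Sum>l\<in>?L. fact (m - length l) * avoid_prob A (m - length l))"
    proof (rule sum_mono)
      fix l assume l: "l \<in> ?L"
      have "S - insert x (set l) = (S - {x}) - set l" by blast
      then have "card (S - insert x (set l)) = m - length l"
        using l by (simp add: card_Diff_subset m_def distinct_card)
      moreover have "S - insert x (set l) \<subset> S" using x by blast
      ultimately show "real (card (avoiding_perms A (S - insert x (set l))))
          \<le> fact (m - length l) * avoid_prob A (m - length l)"
        using psubset.IH by metis
    qed
    also have "\<dots> = (\<Sum>k\<in>?K. \<Sum>l\<in>?D k. fact (m - length l) * avoid_prob A (m - length l))"
    proof -
      have "?L = (\<Union>k\<in>?K. ?D k)" using len by auto
      moreover have "finite (?D k)" for k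
        by (rule finite_subset[OF _ finite_subset_distinct[of "S - {x}"]])
          (use psubset.hyps in auto)
      ultimately show ?thesis
        by (simp only:) (rule sum.UNION_disjoint, auto)
    qed
    also have "\<dots> = (\<Sum>k\<in>?K. fact m * avoid_prob A (m - k))"
    proof (rule sum.cong)
      fix k assume k: "k \<in> ?K"
      have "card (?D k) = \<Prod>{m - k + 1..m}"
        unfolding m_def
        by (rule card_lists_distinct_length_eq) (use k psubset.hyps in \<open>auto simp: m_def\<close>)
      moreover have "fact m = fact (m - k) * (\<Prod>{Suc (m - k)..m} :: nat)"
        by (rule fact_eq_fact_times) simp
      ultimately have "fact (m - k) * card (?D k) = fact m"
        by simp
      from arg_cong[OF this, of real] have "fact (m - k) * real (card (?D k)) = fact m"
        by (simp only: of_nat_fact of_nat_mult)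
      moreover have "(\<Sum>l\<in>?D k. fact (m - length l) * avoid_prob A (m - length l))
          = real (card (?D k)) * (fact (m - k) * avoid_prob A (m - k))"
        by simp
      ultimately show "(\<Sum>l\<in>?D k. fact (m - length l) * avoid_prob A (m - length l))
          = fact m * avoid_prob A (m - k)"
        by (simp add: mult_ac)
    qed simp
    also have "\<dots> = fact m * (\<Sum>j | j < Suc m \<and> Suc m - j \<notin> A. avoid_prob A j)"
      unfolding sum_distrib_left
      by (rule sum.reindex_bij_witness[of _ "\<lambda>j. m - j" "\<lambda>k. m - k"])
        (auto simp: Suc_diff_le)
    also have "\<dots> = fact m * (real (Suc m) * avoid_prob A (Suc m))"
      by (subst avoid_prob_rec) simp_all
    finally show ?thesis by (simp add: n algebra_simps)
  qed
qed

section \<open>Partial sums of the recursion\<close>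

text \<open>
  Let \<open>f\<close> be the truncated generating function and \<open>g(x) = \<Sum>\<^sub>b x\<^sup>b / b\<close>. The terms of \<open>f'\<close> are
  those terms of the product \<open>f g'\<close> whose indices satisfy \<open>i + b \<le> m\<close>, hence \<open>f' \<le> f g'\<close> on \<open>[0,1]\<close>
  and \<open>f exp (-g)\<close> decreases from its value 1 at 0.
\<close>

lemma partial_sum_le_exp:
  fixes p :: "nat \<Rightarrow> real"
  assumes p0: "p 0 = 1" and nonneg: "\<And>j. 0 \<le> p j"
    and rec: "\<And>j. j > 0 \<Longrightarrow> real j * p j = (\<Sum>i | i < j \<and> j - i \<notin> A. p i)"
  shows "(\<Sum>j\<le>m. p j) \<le> exp (\<Sum>b\<in>{1..m} - A. 1 / real b)"
proof -
  let ?B = "{1..m} - A"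
  define f where "f = (\<lambda>x. \<Sum>j\<le>m. p j * x ^ j)"
  define f' where "f' = (\<lambda>x. \<Sum>j\<le>m. real j * p j * x ^ (j - 1))"
  define g where "g = (\<lambda>x::real. \<Sum>b\<in>?B. x ^ b / real b)"
  define g' where "g' = (\<lambda>x::real. \<Sum>b\<in>?B. x ^ (b - 1))"
  have df: "(f has_real_derivative f' x) (at x)" for x
    unfolding f_def f'_def
    by (rule DERIV_sum) (auto intro!: derivative_eq_intros simp: mult_ac)
  have dg: "(g has_real_derivative g' x) (at x)" for x
    unfolding g_def g'_def
    by (rule DERIV_sum) (auto intro!: derivative_eq_intros)
  have le: "f' x \<le> f x * g' x" if x: "0 \<le> x" for x
  proof -
    let ?T = "SIGMA j:{..m}. {i. i < j \<and> j - i \<notin> A}"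
    let ?U = "{(i, b). i + b \<le> m \<and> b \<in> ?B}"
    \<comment> \<open>expand \<open>j p\<^sub>j\<close> by the recursion, then substitute \<open>b = j - i\<close>\<close>
    have "f' x = (\<Sum>j\<le>m. \<Sum>i | i < j \<and> j - i \<notin> A. p i * x ^ (j - 1))"
      unfolding f'_def
    proof (rule sum.cong)
      fix j
      show "real j * p j * x ^ (j - 1) = (\<Sum>i | i < j \<and> j - i \<notin> A. p i * x ^ (j - 1))"
        by (cases "j = 0") (simp_all add: rec sum_distrib_right)
    qed simp
    also have "\<dots> = (\<Sum>(j, i)\<in>?T. p i * x ^ (j - 1))"
      by (rule sum.Sigma) auto
    also have "\<dots> = (\<Sum>(i, b)\<in>?U. p i * x ^ i * x ^ (b - 1))"
      by (rule sum.reindex_bij_witness[of _ "\<lambda>(i, b). (i + b, i)" "\<lambda>(j, i). (i, j - i)"])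
        (auto simp: power_add[symmetric])
    also have "\<dots> \<le> (\<Sum>(i, b)\<in>{..m} \<times> ?B. p i * x ^ i * x ^ (b - 1))"
      using x nonneg by (intro sum_mono2) auto
    also have "\<dots> = f x * g' x"
      unfolding f_def g'_def by (simp add: sum_product sum.cartesian_product)
    finally show ?thesis .
  qed
  have "f 1 * exp (- g 1) \<le> f 0 * exp (- g 0)"
  proof (rule DERIV_nonpos_imp_nonincreasing[of 0 1])
    fix x :: real assume x: "0 \<le> x" "x \<le> 1"
    have "((\<lambda>x. f x * exp (- g x)) has_real_derivative
        (f' x - f x * g' x) * exp (- g x)) (at x)"
      by (auto intro!: derivative_eq_intros df dg simp: algebra_simps)
    moreover have "(f' x - f x * g' x) * exp (- g x) \<le> 0"
      using le[OF x(1)] by (simp add: mult_nonpos_nonneg)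
    ultimately show "\<exists>y. ((\<lambda>x. f x * exp (- g x)) has_real_derivative y) (at x) \<and> y \<le> 0"
      by blast
  qed simp
  also have "f 0 = 1"
    unfolding f_def using p0 by (simp add: power_0_left if_distrib cong: if_cong)
  also have "g 0 = 0"
    unfolding g_def by (rule sum.neutral) auto
  finally show ?thesis
    by (simp add: f_def g_def exp_minus field_simps)
qed

section \<open>The bound with the Euler--Mascheroni constant\<close>

text \<open>
  The sequence \<open>H\<^sub>m - ln (m + 1)\<close> increases to \<open>\<gamma>\<close>, in contrast to \<open>H\<^sub>m - ln m\<close>, which decreases to it.
\<close>

lemma harm_less_ln_plus_euler_mascheroni:
  "harm m < ln (real (Suc m)) + euler_mascheroni"
proof (cases m)
  case 0
  then show ?thesis using euler_mascheroni_pos by (simp add: harm_def)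
next
  case (Suc k)
  have "0 < 1 / real (2 * (k + 2))" by simp
  then have "harm (Suc k) - ln (real (k + 2)) < euler_mascheroni"
    using euler_mascheroni_lower[of k] by linarith
  then show ?thesis using Suc by (simp add: algebra_simps)
qed

text \<open>
  For \<open>n \<notin> A\<close> the partial sum bound suffices. For \<open>n \<in> A\<close> write \<open>X = exp (H\<^sub>m - \<nu>)\<close>. The recursion
  omits \<open>p\<^sub>0 = 1\<close>, and \<open>X - 1 \<le> X (1 - 1/n) \<le> X exp (-1/n)\<close> provided that \<open>X \<le> n\<close>, which holds
  for \<open>\<nu> \<ge> \<gamma>\<close>. For \<open>\<nu> < \<gamma>\<close> the target exceeds \<open>exp (-1/n) \<ge> 1 - 1/n \<ge> p\<^sub>n\<close>.
\<close>

lemma avoid_prob_less: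
  assumes n: "n \<ge> 1" and A: "A \<subseteq> {1..n}"
  shows "avoid_prob A n < exp (euler_mascheroni - (\<Sum>a\<in>A. 1 / real a))"
proof -
  obtain m where m: "n = Suc m" using n by (cases n) auto
  have finA: "finite A" using A finite_subset by blast
  define \<nu> where "\<nu> = (\<Sum>a\<in>A - {n}. 1 / real a)"
  define X where "X = exp (harm m - \<nu>)"
  have "(\<Sum>b\<in>{1..m} - A. 1 / real b) = (\<Sum>b\<in>{1..m} - (A - {n}). 1 / real b)"
    by (rule sum.cong) (auto simp: m)
  also have "\<dots> = harm m - \<nu>"
    unfolding \<nu>_def harm_def using A m
    by (subst sum_diff) (auto simp: divide_simps le_Suc_eq)
  finally have sumB: "(\<Sum>b\<in>{1..m} - A. 1 / real b) = harm m - \<nu>" .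
  have Q: "(\<Sum>j<n. avoid_prob A j) \<le> X"
    using partial_sum_le_exp[of "avoid_prob A" A m] avoid_prob_bounds avoid_prob_rec
    unfolding sumB X_def m lessThan_Suc_atMost by simp
  have "X < exp (ln (real n) + euler_mascheroni - \<nu>)"
    unfolding X_def m using harm_less_ln_plus_euler_mascheroni[of m] by simp
  also have "\<dots> = real n * exp (euler_mascheroni - \<nu>)"
    using n by (simp add: exp_add exp_diff)
  finally have X: "X < real n * exp (euler_mascheroni - \<nu>)" .
  show ?thesis
  proof (cases "n \<in> A")
    case False
    have "real n * avoid_prob A n \<le> (\<Sum>j<n. avoid_prob A j)"
      using n avoid_prob_bounds by (subst avoid_prob_rec) (auto intro!: sum_mono2)
    then have "real n * avoid_prob A n < real n * exp (euler_mascheroni - \<nu>)"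
      using Q X by linarith
    then show ?thesis using n False by (simp add: \<nu>_def)
  next
    case True
    have \<mu>: "(\<Sum>a\<in>A. 1 / real a) = \<nu> + 1 / real n"
      unfolding \<nu>_def using finA True by (simp add: sum.remove)
    have e: "1 - 1 / real n \<le> exp (- (1 / real n))"
      using exp_ge_add_one_self[of "- (1 / real n)"] by simp
    have sum_split: "(\<Sum>j<n. avoid_prob A j) = 1 + (\<Sum>j\<in>{1..<n}. avoid_prob A j)"
      using n by (simp add: lessThan_atLeast0 sum.atLeast_Suc_lessThan)
    have sub: "real n * avoid_prob A n \<le> (\<Sum>j\<in>{1..<n}. avoid_prob A j)"
    proof -
      \<comment> \<open>the index \<open>j = 0\<close> stands for the \<open>n\<close>-cycles, which are forbidden\<close>
      have "j \<noteq> 0" if "n - j \<notin> A" for j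
        using True that by (cases j) auto
      then have "{j. j < n \<and> n - j \<notin> A} \<subseteq> {1..<n}"
        by (auto simp: Suc_le_eq)
      then show ?thesis
        using n avoid_prob_bounds by (subst avoid_prob_rec) (auto intro!: sum_mono2)
    qed
    show ?thesis
    proof (cases "\<nu> < euler_mascheroni")
      case True
      have "(\<Sum>j\<in>{1..<n}. avoid_prob A j) \<le> (\<Sum>j\<in>{1..<n}. 1)"
        using avoid_prob_bounds by (intro sum_mono) auto
      then have "real n * avoid_prob A n \<le> real n * (1 - 1 / real n)"
        using sub n by (simp add: algebra_simps of_nat_diff)
      then have "avoid_prob A n \<le> 1 - 1 / real n"
        using n by simp
      also note e
      also have "exp (- (1 / real n)) < exp (euler_mascheroni - (\<nu> + 1 / real n))"
        using True by simp
      finally show ?thesis unfolding \<mu> .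
    next
      case False
      then have "exp (euler_mascheroni - \<nu>) \<le> 1" by simp
      then have "real n * exp (euler_mascheroni - \<nu>) \<le> real n * 1"
        by (intro mult_left_mono) auto
      then have "X \<le> real n" using X by simp
      then have "X - 1 \<le> X * (1 - 1 / real n)"
        using n by (simp add: field_simps)
      also have "\<dots> \<le> X * exp (- (1 / real n))"
        using e by (intro mult_left_mono) (simp_all add: X_def)
      also have "\<dots> < real n * exp (euler_mascheroni - \<nu>) * exp (- (1 / real n))"
        using X by simp
      also have "\<dots> = real n * exp (euler_mascheroni - (\<nu> + 1 / real n))"
        by (simp add: mult.assoc exp_add[symmetric])
      finally have "real n * avoid_prob A n < real n * exp (euler_mascheroni - (\<nu> + 1 / real n))"
        using sub sum_split Q by linarith
      then show ?thesis using n unfolding \<mu> by simp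
    qed
  qed
qed

section \<open>Symmetric and alternating groups\<close>

lemma avoiding_proportion_sym_group_le:
  "avoiding_proportion n (sym_group n) A \<le> avoid_prob A n"
proof -
  have "{g \<in> carrier (sym_group n). cycle_lengths n g \<inter> A = {}} = avoiding_perms A {1..n}"
    by (auto simp: sym_group_carrier avoiding_perms_def cycle_lengths_def)
  then show ?thesis
    using card_avoiding_perms_le[of "{1..n}" A]
    by (simp add: avoiding_proportion_def order_def sym_group_card_carrier field_simps)
qed

text \<open>
  An inequality, since the two groups coincide for \<open>n \<le> 1\<close>.
\<close>

lemma order_sym_group_le: "order (sym_group n) \<le> 2 * order (alt_group n)"
proof (cases "n \<ge> 2")
  case True
  then show ?thesis
    unfolding order_def sym_group_card_carrier alt_group_card_carrier[OF True] by simp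
next
  case False
  have "finite (carrier (alt_group n))"
    by (rule finite_subset[OF _ finite_permutations[of "{1..n}"]])
      (auto simp: alt_group_carrier)
  moreover have "id \<in> carrier (alt_group n)"
    by (simp add: alt_group_carrier permutes_id)
  ultimately have "order (alt_group n) \<ge> 1"
    unfolding order_def by (metis One_nat_def Suc_leI card_gt_0_iff empty_iff)
  moreover have "order (sym_group n) = 1"
  proof -
    have "n = 0 \<or> n = 1" using False by linarith
    then show ?thesis by (auto simp: order_def sym_group_card_carrier)
  qed
  ultimately show ?thesis by simp
qed

lemma avoiding_proportion_alt_group_le:
  "avoiding_proportion n (alt_group n) A \<le> 2 * avoiding_proportion n (sym_group n) A"
proof -
  let ?c = "\<lambda>G. card {g \<in> carrier G. cycle_lengths n g \<inter> A = {}}"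
  have pos: "order (sym_group n) > 0"
    by (simp add: order_def sym_group_card_carrier)
  have "?c (alt_group n) \<le> ?c (sym_group n)"
    by (rule card_mono, rule finite_subset[OF _ finite_permutations[of "{1..n}"]])
      (auto simp: alt_group_carrier sym_group_carrier)
  then have "real (?c (alt_group n)) * real (order (sym_group n))
      \<le> real (?c (sym_group n)) * real (2 * order (alt_group n))"
    using order_sym_group_le[of n] by (intro mult_mono) (auto simp del: of_nat_mult)
  then show ?thesis
    using pos order_sym_group_le[of n]
    by (simp add: avoiding_proportion_def divide_simps mult_ac)
qed

theorem proposition6:
  fixes n :: nat and A :: "nat set" and \<mu> :: real
  assumes "n \<ge> 1"
    and "A \<subseteq> {1..n}"
    and "\<mu> = (\<Sum>a\<in>A. 1 / real a)"
  shows "avoiding_proportion n (sym_group n) A < exp (euler_mascheroni - \<mu>)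
    \<and> avoiding_proportion n (alt_group n) A < 2 * exp (euler_mascheroni - \<mu>)"
  using avoiding_proportion_sym_group_le[of n A] avoiding_proportion_alt_group_le[of n A]
    avoid_prob_less[OF assms(1,2)]
  unfolding assms(3) by linarith

end
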